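(* Assume that the noise terms $\xi_i$ are subgaussian with parameter $\sigma>0$, i.e. $\mathbb E[e^{u\xi_i}]\le e^{u^2\sigma^2/2}$ for all $u\in\mathbb R$. Then there exist two positive constants $C_1$ and $C_2$, which depend on $d$ and $\sigma$ only, such that for all integers $n\ge 1$ and $r\ge d+1$, the estimator $\hat P_n^{(r)}$ satisfies $$\sup_{P\in\mathcal P_r}\mathbb P_{P}\Big[n\Big(|\hat P_n^{(r)}\triangle P|-\frac{2dr\ln n}{C_2n}\Big)\geq x\Big] \leq C_1e^{-C_2x},\qquad \forall x>0.$$
   Context: Let $d\ge 2$ be an integer. One observes $n$ i.i.d. pairs $(X_i,Y_i)$, $i=1,\dots,n$, with $X_i$ uniformly distributed on $[0,1]^d$ and $Y_i=I(X_i\in G)+\xi_i$, where $G\subseteq[0,1]^d$ is unknown, $I(\cdot\in G)$ is the indicator function of $G$, and the errors $\xi_1,\dots,\xi_n$ are i.i.d. real random variables independent of $(X_1,\dots,X_n)$. $\mathbb P_G$ denotes the probability measure associated with the distribution of the $n$ pairs. $|\cdot|$ is Lebesgue measure on $\mathbb R^d$ and $\triangle$ is symmetric difference. All convex sets (in particular polytopes) considered are compact with nonempty interior. For $r\ge d+1$, $\mathcal P_r$ is the class of all convex polytopes contained in $[0,1]^d$ with at most $r$ vertices, and $\mathcal P_r^{(n)}$ is the (finite) class of all convex polytopes in $[0,1]^d$ with at most $r$ vertices whose vertices have coordinates that are integer multiples of $1/n$. Put $\mathcal A(P)=\sum_{i=1}^n(1-2Y_i)I(X_i\in P)$. The estimator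 $\hat P_n^{(r)}$ is any (measurable) choice of an element of $\operatorname{argmin}_{P\in\mathcal P_r^{(n)}}\mathcal A(P)$. *)

theory Defs
  imports "HOL-Probability.Probability"
begin

text \<open>Vertices are the extreme points of a polytope (equivalently, its zero-dimensional faces).\<close>

definition vertices :: "(real ^ 'd) set \<Rightarrow> (real ^ 'd) set" where
  "vertices P = {v. v extreme_point_of P}"

definition polytope_class :: "nat \<Rightarrow> (real ^ 'd) set set" where
  "polytope_class r =
     {P. polytope P \<and> interior P \<noteq> {} \<and> P \<subseteq> cbox 0 1 \<and> card (vertices P) \<le> r}"

definition grid_polytope_class :: "nat \<Rightarrow> nat \<Rightarrow> (real ^ 'd) set set" where
  "grid_polytope_class n r =
     {P \<in> polytope_class r. \<forall>v\<in>vertices P. \<forall>i. \<exists>k::int. v $ i = of_int k * (1 / real n)}"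

text \<open>The integral is a nonnegative one with values in \<^typ>\<open>ennreal\<close>, so the inequality includes
  the finiteness of the exponential moments.\<close>

definition subgaussian_law :: "real \<Rightarrow> real measure \<Rightarrow> bool" where
  "subgaussian_law \<sigma> \<nu> \<longleftrightarrow>
     prob_space \<nu> \<and> sets \<nu> = sets borel \<and>
     (\<forall>u. (\<integral>\<^sup>+ e. ennreal (exp (u * e)) \<partial>\<nu>) \<le> ennreal (exp (u\<^sup>2 * \<sigma>\<^sup>2 / 2)))"

text \<open>The law of a single pair \<open>(X, I(X \<in> G) + \<xi>)\<close>, where \<open>X\<close> is uniform on the unit cube and
  independent of \<open>\<xi>\<close>, which has law \<open>\<nu>\<close>.\<close>

definition pair_law :: "real measure \<Rightarrow> (real ^ 'd) set \<Rightarrow> ((real ^ 'd) \<times> real) measure" where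
  "pair_law \<nu> G =
     distr (uniform_measure lborel (cbox 0 1) \<Otimes>\<^sub>M \<nu>) (borel \<Otimes>\<^sub>M borel)
       (\<lambda>(x, e). (x, indicator G x + e))"

text \<open>A sample of size \<open>n\<close> is a function on the index set \<open>{1..n}\<close>, and \<open>sample_law \<nu> n G\<close> is the
  measure \<open>\<P>\<^sub>G\<close>. Working with the law itself, rather than with random variables on
  an unspecified probability space, allows the noise distribution to be quantified
  inside the choice of the constants.\<close>

definition sample_law ::
    "real measure \<Rightarrow> nat \<Rightarrow> (real ^ 'd) set \<Rightarrow> (nat \<Rightarrow> (real ^ 'd) \<times> real) measure" where
  "sample_law \<nu> n G = (\<Pi>\<^sub>M i\<in>{1..n}. pair_law \<nu> G)"

definition sample_space :: "nat \<Rightarrow> (nat \<Rightarrow> (real ^ 'd) \<times> real) measure" where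
  "sample_space n = (\<Pi>\<^sub>M i\<in>{1..n}. borel \<Otimes>\<^sub>M borel)"

text \<open>Any realization of the regression model by random variables has this law.\<close>

lemma distr_sample_eq_sample_law:
  fixes X :: "nat \<Rightarrow> 'w \<Rightarrow> real ^ 'd" and \<xi> :: "nat \<Rightarrow> 'w \<Rightarrow> real"
  assumes M: "prob_space M" and n: "n \<ge> 1" and G: "G \<in> sets borel"
    and iid: "prob_space.indep_vars M (\<lambda>_. borel \<Otimes>\<^sub>M borel) (\<lambda>i w. (X i w, \<xi> i w)) {1..n}"
    and joint: "\<And>i. i \<in> {1..n} \<Longrightarrow> distr M (borel \<Otimes>\<^sub>M borel) (\<lambda>w. (X i w, \<xi> i w))
                  = uniform_measure lborel (cbox 0 1) \<Otimes>\<^sub>M \<nu>"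
  shows "distr M (sample_space n) (\<lambda>w. \<lambda>i\<in>{1..n}. (X i w, indicator G (X i w) + \<xi> i w))
    = sample_law \<nu> n G"
proof -
  interpret prob_space M by fact
  let ?B = "borel \<Otimes>\<^sub>M borel :: ((real ^ 'd) \<times> real) measure"
  let ?f = "\<lambda>(x, e). (x, indicator G x + e) :: (real ^ 'd) \<times> real"
  have f: "?f \<in> measurable ?B ?B"
    using G by measurable
  have ind: "indep_vars (\<lambda>_. ?B) (\<lambda>i w. ?f (X i w, \<xi> i w)) {1..n}"
    by (rule indep_vars_compose2[OF iid f])
  have rv: "random_variable ?B (\<lambda>w. ?f (X i w, \<xi> i w))" if "i \<in> {1..n}" for i
    using ind that unfolding indep_vars_def by blast
  have pair: "distr M ?B (\<lambda>w. ?f (X i w, \<xi> i w)) = pair_law \<nu> G" if i: "i \<in> {1..n}" for i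
  proof -
    have XE: "random_variable ?B (\<lambda>w. (X i w, \<xi> i w))"
      using iid i unfolding indep_vars_def by blast
    have "distr (distr M ?B (\<lambda>w. (X i w, \<xi> i w))) ?B ?f = distr M ?B (?f \<circ> (\<lambda>w. (X i w, \<xi> i w)))"
      by (rule distr_distr[OF f XE])
    then show ?thesis
      unfolding pair_law_def joint[OF i] by (simp add: comp_def)
  qed
  have "distr M (\<Pi>\<^sub>M i\<in>{1..n}. ?B) (\<lambda>w. \<lambda>i\<in>{1..n}. ?f (X i w, \<xi> i w))
      = (\<Pi>\<^sub>M i\<in>{1..n}. distr M ?B (\<lambda>w. ?f (X i w, \<xi> i w)))"
    by (rule iffD1[OF indep_vars_iff_distr_eq_PiM' ind]) (use n in simp, rule rv)
  also have "\<dots> = (\<Pi>\<^sub>M i\<in>{1..n}. pair_law \<nu> G)"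
    by (rule PiM_cong) (simp_all only: pair)
  finally show ?thesis
    by (simp add: sample_space_def sample_law_def)
qed

definition emp_criterion :: "nat \<Rightarrow> (nat \<Rightarrow> (real ^ 'd) \<times> real) \<Rightarrow> (real ^ 'd) set \<Rightarrow> real" where
  "emp_criterion n z P = (\<Sum>i=1..n. (1 - 2 * snd (z i)) * indicator P (fst (z i)))"

text \<open>As the class of grid polytopes is finite, measurability with respect to its discrete
  \<open>\<sigma>\<close>-algebra means that every event \<open>phat = Q\<close> is measurable.\<close>

definition polytope_estimator ::
    "nat \<Rightarrow> nat \<Rightarrow> ((nat \<Rightarrow> (real ^ 'd) \<times> real) \<Rightarrow> (real ^ 'd) set) \<Rightarrow> bool" where
  "polytope_estimator n r phat \<longleftrightarrow>
     phat \<in> measurable (sample_space n) (count_space (grid_polytope_class n r)) \<and>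
     (\<forall>z\<in>space (sample_space n).
        is_arg_min (emp_criterion n z) (\<lambda>Q. Q \<in> grid_polytope_class n r) (phat z))"

end

theory Submission
  imports Defs
begin

text \<open>Let \<open>P\<close> be the true polytope and \<open>R\<close> a grid polytope. If the estimator is \<open>Q\<close>, then
  \<open>\<A>(Q) \<le> \<A>(R)\<close>, and since \<open>(1 - 2 I\<^sub>P) (I\<^sub>Q - I\<^sub>R) = I\<^bsub>Q \<triangle> P\<^esub> - I\<^bsub>R \<triangle> P\<^esub>\<close>, a Chernoff bound
  gives this event probability at most \<open>exp (n (K |R \<triangle> P| - \<kappa> |Q \<triangle> P|))\<close>,
  where \<open>\<kappa> = gain_rate \<sigma>\<close> and \<open>K = loss_rate \<sigma>\<close>. A union bound over the at most
  \<open>(n + 1)\<^bsup>dr\<^esup> \<le> n\<^bsup>2dr\<^esup>\<close> grid polytopes (\<open>n \<ge> 2\<close>) finishes the proof if \<open>R\<close> can be chosen with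
  \<open>|R \<triangle> P| \<le> c / n\<close> for some \<open>c\<close> depending on \<open>d\<close> only (not on \<open>r\<close>).

  Rounding the vertices of \<open>P\<close> down to the grid does this, because a convex body in the unit cube gains
  volume at most \<open>O(1/n)\<close> when it is swept along a segment of length \<open>1/n\<close>: the \<open>n\<close> translates of the gained
  layer along the segment direction are disjoint and stay in a fixed ball. Sweeping along all
  coordinate directions produces a convex set containing the rounded vertices (and conversely).\<close>

subsection \<open>Volume gained by sweeping a convex body\<close>

text \<open>The Minkowski sum of \<open>L\<close> with the segment from 0 to \<open>w\<close>. As an
  image of a product it inherits compactness and convexity.\<close>

definition sweep :: "'a::real_vector \<Rightarrow> 'a set \<Rightarrow> 'a set" where
  "sweep w L = (\<lambda>(t, x). x + t *\<^sub>R w) ` ({0..1} \<times> L)"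

lemma mem_sweep: "y \<in> sweep w L \<longleftrightarrow> (\<exists>t x. 0 \<le> t \<and> t \<le> 1 \<and> x \<in> L \<and> y = x + t *\<^sub>R w)"
  by (auto simp: sweep_def)

lemma subset_sweep: "L \<subseteq> sweep w L"
  by (auto simp: mem_sweep intro!: exI[of _ "0::real"])

lemma compact_sweep:
  fixes w :: "'a::real_normed_vector"
  assumes "compact L"
  shows "compact (sweep w L)"
  unfolding sweep_def case_prod_beta
  by (intro compact_continuous_image compact_Times continuous_intros assms) auto

lemma convex_sweep:
  assumes "convex L"
  shows "convex (sweep w L)"
proof -
  have "linear (\<lambda>z::real \<times> 'a. snd z + fst z *\<^sub>R w)"
    by (rule linearI) (simp_all add: algebra_simps)
  then show ?thesis
    unfolding sweep_def case_prod_beta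
    by (rule convex_linear_image) (intro convex_Times assms convex_real_interval)
qed

text \<open>On each line in direction \<open>w\<close> the set \<open>sweep w L - L\<close> is a layer just beyond the end of
  \<open>L\<close>, which makes its translates by multiples of \<open>w\<close> disjoint.\<close>

lemma disjnt_translated_layers:
  fixes w :: "'a::real_vector"
  assumes "convex L" and "k < (l::nat)"
  shows "disjnt ((+) (real k *\<^sub>R w) ` (sweep w L - L)) ((+) (real l *\<^sub>R w) ` (sweep w L - L))"
proof -
  have False
    if x: "x \<in> L" and t: "t \<le> 1" and x': "x' \<in> L" and t': "0 \<le> t'" "x' + t' *\<^sub>R w \<notin> L"
      and eq: "real k *\<^sub>R w + (x + t *\<^sub>R w) = real l *\<^sub>R w + (x' + t' *\<^sub>R w)" for x x' t t'
  proof -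
    \<comment> \<open>Equating the two expressions gives \<open>x = x' + s *\<^sub>R w\<close>.
      Since \<open>l - k\<close> is at least 1 and \<open>t\<close> at most 1,
      \<open>t' \<le> s\<close>, so \<open>x' + t' *\<^sub>R w\<close> is on the segment from
      \<open>x'\<close> to \<open>x\<close>.\<close>
    define s where "s = t' + real l - real k - t"
    have s: "t' \<le> s"
      using assms(2) t by (simp add: s_def)
    have xs: "x = x' + s *\<^sub>R w"
      using eq by (simp add: s_def algebra_simps)
    have "s > 0"
      using s t' x' by (cases "s = 0") auto
    then have "x' + t' *\<^sub>R w = (1 - t' / s) *\<^sub>R x' + (t' / s) *\<^sub>R x"
      by (simp add: xs algebra_simps)
    also have "\<dots> \<in> L"
      by (rule convexD_alt[OF assms(1) x' x]) (use s t' \<open>s > 0\<close> in auto)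
    finally show False
      using t' by simp
  qed
  then show ?thesis
    unfolding disjnt_def by (force simp: mem_sweep)
qed

text \<open>The \<open>n\<close> translates of the layer are disjoint, have equal measure and lie in
  \<open>B\<close>: a point \<open>x + t *\<^sub>R w\<close> of the layer moves to parameter
  \<open>k + t\<close>, which is at most \<open>n\<close> because \<open>k < n\<close> and
  \<open>t \<le> 1\<close>.\<close>

lemma measure_layer_le:
  fixes w :: "'a::euclidean_space"
  assumes L: "compact L" "convex L" and n: "n \<ge> 1" and B: "B \<in> lmeasurable"
    and sub: "\<And>x t. x \<in> L \<Longrightarrow> 0 \<le> t \<Longrightarrow> t \<le> real n \<Longrightarrow> x + t *\<^sub>R w \<in> B"
  shows "measure lebesgue (sweep w L - L) \<le> measure lebesgue B / real n"
proof -
  let ?U = "sweep w L - L"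
  let ?T = "\<lambda>k::nat. (+) (real k *\<^sub>R w) ` ?U"
  have U: "?U \<in> lmeasurable"
    by (intro fmeasurable.Diff lmeasurable_compact compact_sweep L)
  have "real n * measure lebesgue ?U = (\<Sum>k<n. measure lebesgue (?T k))"
    by (simp add: measure_translation)
  also have "\<dots> = measure lebesgue (\<Union>k<n. ?T k)"
  proof (rule measure_UNION'[symmetric])
    show "pairwise (\<lambda>i j. disjnt (?T i) (?T j)) {..<n}"
      unfolding pairwise_def
      by (metis disjnt_translated_layers[OF L(2)] disjnt_sym linorder_neqE_nat)
  qed (use U measurable_translation in auto)
  also have "\<dots> \<le> measure lebesgue B"
  proof (rule measure_mono_fmeasurable[OF _ _ B])
    show "(\<Union>k<n. ?T k) \<subseteq> B"
    proof clarsimp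
      fix k y assume k: "k < n" and y: "y \<in> sweep w L"
      from y obtain t x where tx: "0 \<le> t" "t \<le> 1" "x \<in> L" "y = x + t *\<^sub>R w"
        by (auto simp: mem_sweep)
      have "x + (real k + t) *\<^sub>R w \<in> B"
        by (rule sub) (use tx k in auto)
      then show "real k *\<^sub>R w + y \<in> B"
        by (simp add: tx algebra_simps)
    qed
    show "(\<Union>k<n. ?T k) \<in> sets lebesgue"
      using U measurable_translation by blast
  qed
  finally show ?thesis
    using n by (simp add: field_simps)
qed

text \<open>Sweeping along one direction at a time costs one ball volume over \<open>n\<close> per
  direction. The containment in a ball is carried through the induction so that the translates of
  the next layer have a set to stay in.\<close>

lemma ex_convex_superset_small_excess:
  fixes w :: "'i \<Rightarrow> 'a::euclidean_space"
  assumes "finite I" and "\<And>i. i \<in> I \<Longrightarrow> norm (w i) \<le> 1 / real n" and n: "n \<ge> 1"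
    and K: "compact K" "convex K" "K \<subseteq> cball 0 R"
  shows "\<exists>L. compact L \<and> convex L \<and> K \<subseteq> L \<and> L \<subseteq> cball 0 (R + real (card I)) \<and>
    (\<forall>x\<in>K. \<forall>t. (\<forall>i\<in>I. 0 \<le> t i \<and> t i \<le> 1) \<longrightarrow> x + (\<Sum>i\<in>I. t i *\<^sub>R w i) \<in> L) \<and>
    measure lebesgue (L - K)
      \<le> real (card I) * measure lebesgue (cball (0::'a) (R + real (card I))) / real n"
  using assms(1,2)
proof (induction I)
  case empty
  show ?case
    using K by (intro exI[of _ K]) auto
next
  case (insert i I)
  let ?c = "real (card I)"
  obtain L where L: "compact L" "convex L" "K \<subseteq> L" "L \<subseteq> cball 0 (R + ?c)"
    and L_mem: "\<And>x t. x \<in> K \<Longrightarrow> (\<And>i. i \<in> I \<Longrightarrow> 0 \<le> t i \<and> t i \<le> 1) \<Longrightarrow>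
      x + (\<Sum>i\<in>I. t i *\<^sub>R w i) \<in> L"
    and L_meas: "measure lebesgue (L - K) \<le> ?c * measure lebesgue (cball (0::'a) (R + ?c)) / real n"
    using insert by auto
  have nw: "norm (w i) \<le> 1 / real n"
    using insert by auto
  \<comment> \<open>A distance of \<open>n\<close> steps of length at most \<open>1 / n\<close> is
    at most 1, so the radius need only grow by 1.\<close>
  have sub: "x + t *\<^sub>R w i \<in> cball 0 (R + (?c + 1))" if "x \<in> L" "0 \<le> t" "t \<le> real n" for x t
  proof -
    have "norm x \<le> R + ?c"
      using L(4) that(1) by auto
    moreover have "t * norm (w i) \<le> real n * (1 / real n)"
      by (rule mult_mono) (use that nw in auto)
    ultimately have "norm (x + t *\<^sub>R w i) \<le> R + (?c + 1)"
      using norm_triangle_ineq[of x "t *\<^sub>R w i"] n that by auto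
    then show ?thesis
      by simp
  qed
  let ?S = "sweep (w i) L"
  have cS: "compact ?S" "convex ?S"
    by (auto intro: compact_sweep convex_sweep L)
  have "measure lebesgue (?S - K) \<le> measure lebesgue ((?S - L) \<union> (L - K))"
    using cS L K
    by (intro measure_mono_fmeasurable fmeasurable.Un fmeasurableD fmeasurable.Diff lmeasurable_compact) auto
  also have "\<dots> \<le> measure lebesgue (?S - L) + measure lebesgue (L - K)"
    using cS L K
    by (intro measure_Un_le fmeasurableD fmeasurable.Diff lmeasurable_compact) auto
  \<comment> \<open>The earlier layers are also charged to the larger ball, so that all layers share
    one bound.\<close>
  also have "\<dots> \<le> measure lebesgue (cball (0::'a) (R + (?c + 1))) / real n
      + ?c * measure lebesgue (cball (0::'a) (R + (?c + 1))) / real n"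
  proof (rule add_mono)
    show "measure lebesgue (?S - L) \<le> measure lebesgue (cball (0::'a) (R + (?c + 1))) / real n"
      by (rule measure_layer_le[OF L(1,2) n _ sub]) auto
    have "measure lebesgue (cball (0::'a) (R + ?c)) \<le> measure lebesgue (cball (0::'a) (R + (?c + 1)))"
      by (rule measure_mono_fmeasurable) auto
    then show "measure lebesgue (L - K)
        \<le> ?c * measure lebesgue (cball (0::'a) (R + (?c + 1))) / real n"
      using L_meas by (smt (verit) divide_right_mono mult_left_mono of_nat_0_le_iff)
  qed
  finally have meas: "measure lebesgue (?S - K)
      \<le> real (card (insert i I)) * measure lebesgue (cball (0::'a) (R + real (card (insert i I)))) / real n"
    using insert.hyps by (simp add: add_divide_distrib distrib_right add_ac)
  have mem: "x + (\<Sum>i\<in>insert i I. t i *\<^sub>R w i) \<in> ?S"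
    if "x \<in> K" "\<forall>i\<in>insert i I. 0 \<le> t i \<and> t i \<le> 1" for x t
  proof -
    have "x + (\<Sum>i\<in>I. t i *\<^sub>R w i) \<in> L"
      by (rule L_mem) (use that in auto)
    then show ?thesis
      using that insert.hyps by (force simp: mem_sweep algebra_simps)
  qed
  have "?S \<subseteq> cball 0 (R + real (card (insert i I)))"
  proof
    fix y assume "y \<in> ?S"
    then obtain t x where tx: "0 \<le> t" "t \<le> 1" "x \<in> L" "y = x + t *\<^sub>R w i"
      by (auto simp: mem_sweep)
    then show "y \<in> cball 0 (R + real (card (insert i I)))"
      using sub[of x t] n insert.hyps by (simp add: add_ac)
  qed
  then show ?case
    using cS L(3) subset_sweep[of L "w i"] mem meas
    by (intro exI[of _ ?S]) blast
qed

text \<open>The offsets \<open>a - x\<close> have coordinates of one sign \<open>s\<close>, so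
  sweeping \<open>K\<close> along the vectors \<open>(s / n) b\<close> catches every point of
  \<open>A\<close> and, by convexity, the hull. The number of points of \<open>A\<close> does not
  enter, which keeps the final constants independent of \<open>r\<close>.\<close>

lemma measure_convex_hull_diff_le:
  fixes K A :: "'a::euclidean_space set" and s :: real
  assumes K: "compact K" "convex K" "K \<subseteq> cball 0 R" and n: "n \<ge> 1" and A: "finite A"
    and s: "s * s = 1"
    and near: "\<And>a. a \<in> A \<Longrightarrow>
      \<exists>x\<in>K. \<forall>b\<in>Basis. 0 \<le> s * ((a - x) \<bullet> b) \<and> s * ((a - x) \<bullet> b) \<le> 1 / real n"
  shows "measure lebesgue (convex hull A - K)
    \<le> real DIM('a) * measure lebesgue (cball (0::'a) (R + real DIM('a))) / real n"
proof -
  let ?w = "\<lambda>b::'a. (s / real n) *\<^sub>R b"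
  have "\<bar>s\<bar> = 1"
    using s by (metis abs_mult_self_eq abs_1 power2_eq_1_iff power2_eq_square abs_minus_cancel)
  then have "norm (?w b) \<le> 1 / real n" if "b \<in> Basis" for b
    using that by simp
  then obtain L where L: "compact L" "convex L" "K \<subseteq> L"
    and L_mem: "\<And>x t. x \<in> K \<Longrightarrow> (\<And>i. i \<in> Basis \<Longrightarrow> 0 \<le> t i \<and> t i \<le> 1) \<Longrightarrow>
      x + (\<Sum>b\<in>Basis. t b *\<^sub>R ?w b) \<in> L"
    and L_meas: "measure lebesgue (L - K)
      \<le> real DIM('a) * measure lebesgue (cball (0::'a) (R + real DIM('a))) / real n"
    using ex_convex_superset_small_excess[OF finite_Basis, of ?w n K R] n K by auto
  have "a \<in> L" if a: "a \<in> A" for a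
  proof -
    obtain x where x: "x \<in> K"
      and b: "\<And>b. b \<in> Basis \<Longrightarrow> 0 \<le> s * ((a - x) \<bullet> b) \<and> s * ((a - x) \<bullet> b) \<le> 1 / real n"
      using near[OF a] by blast
    \<comment> \<open>These weights lie in [0, 1], and since \<open>s * s = 1\<close> they reproduce
      \<open>a - x\<close> from the vectors \<open>?w b\<close>.\<close>
    let ?t = "\<lambda>b. real n * (s * ((a - x) \<bullet> b))"
    have "x + (\<Sum>b\<in>Basis. ?t b *\<^sub>R ?w b) \<in> L"
    proof (intro L_mem x conjI)
      fix b :: 'a assume "b \<in> Basis"
      note b = b[OF this]
      show "0 \<le> ?t b"
        using b by (intro mult_nonneg_nonneg[OF of_nat_0_le_iff]) blast
      have "?t b \<le> real n * (1 / real n)"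
        using b by (intro mult_left_mono[OF _ of_nat_0_le_iff]) blast
      then show "?t b \<le> 1"
        using n by simp
    qed
    also have "(\<Sum>b\<in>Basis. ?t b *\<^sub>R ?w b) = (\<Sum>b\<in>Basis. ((a - x) \<bullet> b) *\<^sub>R b)"
    proof (rule sum.cong[OF refl])
      fix b :: 'a
      have "?t b * (s / real n) = (s * s) * ((a - x) \<bullet> b)"
        using n by simp
      then show "?t b *\<^sub>R ?w b = ((a - x) \<bullet> b) *\<^sub>R b"
        by (simp only: s scaleR_scaleR mult_1)
    qed
    also have "x + \<dots> = a"
      by (simp only: euclidean_representation) simp
    finally show ?thesis .
  qed
  then have "convex hull A \<subseteq> L"
    using L(2) by (intro hull_minimal) auto
  then have "measure lebesgue (convex hull A - K) \<le> measure lebesgue (L - K)"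
    using A L K
    by (intro measure_mono_fmeasurable fmeasurableD fmeasurable.Diff lmeasurable_compact
        finite_imp_compact_convex_hull) auto
  with L_meas show ?thesis
    by linarith
qed

subsection \<open>Grid polytopes\<close>

lemma polytope_eq_convex_hull_vertices:
  assumes "polytope P"
  shows "P = convex hull (vertices P)"
  unfolding vertices_def
  by (rule Krein_Milman_Minkowski) (use assms polytope_imp_compact polytope_imp_convex in auto)

lemma finite_vertices:
  assumes "polytope P"
  shows "finite (vertices P)"
  unfolding vertices_def
  by (rule finite_polyhedron_extreme_points) (use assms polytope_imp_polyhedron in auto)

lemma vertices_convex_hull_subset: "vertices (convex hull A) \<subseteq> A"
  unfolding vertices_def using extreme_point_of_convex_hull by blast

section \<open>Symmetric differences and rounding to the grid\<close>

lemma sym_diff_lmeasurable: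
  assumes "A \<in> lmeasurable" "B \<in> lmeasurable"
  shows "sym_diff A B \<in> lmeasurable"
  using assms by (intro fmeasurable.Un fmeasurable_Diff fmeasurableD) auto

lemma measure_sym_diff_le:
  assumes "A \<in> lmeasurable" "B \<in> lmeasurable"
  shows "measure lebesgue (sym_diff A B) \<le> measure lebesgue (A - B) + measure lebesgue (B - A)"
  using assms by (intro measure_Un_le) auto

text \<open>Rounding down, not to the nearest grid point, gives all coordinate errors the same sign,
  as \<open>measure_convex_hull_diff_le\<close> requires.\<close>

definition round_down :: "nat \<Rightarrow> real ^ 'd \<Rightarrow> real ^ 'd" where
  "round_down n v = (\<chi> i. of_int \<lfloor>real n * v $ i\<rfloor> * (1 / real n))"

lemma round_down_bounds:
  assumes "n \<ge> 1"
  shows "0 \<le> v $ i - round_down n v $ i" "v $ i - round_down n v $ i \<le> 1 / real n"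
proof -
  have *: "v $ i - round_down n v $ i = (real n * v $ i - of_int \<lfloor>real n * v $ i\<rfloor>) / real n"
    using assms by (simp add: round_down_def field_simps)
  show "0 \<le> v $ i - round_down n v $ i"
    unfolding * by (intro divide_nonneg_nonneg) auto
  show "v $ i - round_down n v $ i \<le> 1 / real n"
    unfolding * by (intro divide_right_mono) linarith+
qed

lemma mem_unit_cbox_cart: "(v :: real ^ 'd) \<in> cbox 0 1 \<longleftrightarrow> (\<forall>i. 0 \<le> v $ i \<and> v $ i \<le> 1)"
  by (simp add: mem_box_cart)

lemma round_down_mem_cbox:
  fixes v :: "real ^ 'd"
  assumes n: "n \<ge> 1" and v: "v \<in> cbox 0 1"
  shows "round_down n v \<in> cbox 0 1"
  unfolding mem_unit_cbox_cart
proof (intro allI conjI)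
  fix i
  have "0 \<le> v $ i" "v $ i \<le> 1"
    using v by (auto simp: mem_unit_cbox_cart)
  then show "0 \<le> round_down n v $ i" "round_down n v $ i \<le> 1"
    using round_down_bounds(1)[OF n, of v i] by (auto simp: round_down_def)
qed

lemma unit_cbox_subset_cball: "cbox 0 (1 :: real ^ 'd) \<subseteq> cball 0 (real CARD('d))"
proof
  fix v :: "real ^ 'd" assume "v \<in> cbox 0 1"
  then have "(\<Sum>i\<in>UNIV. \<bar>v $ i\<bar>) \<le> (\<Sum>i\<in>(UNIV :: 'd set). 1)"
    by (intro sum_mono) (auto simp: mem_unit_cbox_cart)
  then show "v \<in> cball 0 (real CARD('d))"
    using norm_le_l1_cart[of v] by simp
qed

text \<open>A fallback of small volume and nonempty interior, for polytopes whose rounding is flat.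
  Spanned by d + 1 points, it fits every class with \<open>r\<close> at least d + 1.\<close>

definition corner_simplex :: "nat \<Rightarrow> (real ^ 'd) set" where
  "corner_simplex n = convex hull (insert 0 ((*\<^sub>R) (1 / real n) ` Basis))"

lemma corner_simplex_scaled:
  "corner_simplex n = (*\<^sub>R) (1 / real n) ` (convex hull (insert 0 Basis :: (real ^ 'd) set))"
  unfolding corner_simplex_def by (subst convex_hull_scaling[symmetric]) simp

lemma measure_corner_simplex_le:
  assumes n: "n \<ge> 1"
  shows "measure lebesgue (corner_simplex n :: (real ^ 'd) set) \<le> 1 / real n"
proof -
  let ?c = "(\<chi> i. 1 / real n) :: real ^ 'd"
  have "insert 0 ((*\<^sub>R) (1 / real n) ` Basis) \<subseteq> cbox 0 ?c"
    by (auto simp: Basis_vec_def mem_box_cart axis_def)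
  then have "corner_simplex n \<subseteq> cbox 0 ?c"
    unfolding corner_simplex_def by (intro hull_minimal convex_box) auto
  then have "measure lebesgue (corner_simplex n :: (real ^ 'd) set) \<le> measure lebesgue (cbox 0 ?c)"
    by (rule measure_mono_fmeasurable)
      (auto simp: corner_simplex_def intro!: fmeasurableD lmeasurable_compact finite_imp_compact_convex_hull)
  also have "\<dots> = (1 / real n) ^ CARD('d)"
    by (simp add: content_cbox_if_cart interval_eq_empty_cart)
  also have "\<dots> \<le> (1 / real n) ^ 1"
    by (rule power_decreasing) (use n in \<open>auto simp: Suc_le_eq\<close>)
  finally show ?thesis
    by simp
qed

lemma corner_simplex_in_grid_polytope_class:
  assumes n: "n \<ge> 1" and r: "r \<ge> CARD('d) + 1"
  shows "(corner_simplex n :: (real ^ 'd) set) \<in> grid_polytope_class n r"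
proof -
  let ?A = "insert 0 ((*\<^sub>R) (1 / real n) ` Basis) :: (real ^ 'd) set"
  let ?S = "corner_simplex n :: (real ^ 'd) set"
  have V: "vertices ?S \<subseteq> ?A"
    unfolding corner_simplex_def by (rule vertices_convex_hull_subset)
  have "card (vertices ?S) \<le> card ?A"
    using V by (intro card_mono) auto
  also have "\<dots> \<le> Suc (card ((*\<^sub>R) (1 / real n) ` (Basis :: (real ^ 'd) set)))"
    by (rule card_insert_le_m1) auto
  also have "\<dots> \<le> r"
    using card_image_le[of "Basis :: (real ^ 'd) set" "(*\<^sub>R) (1 / real n)"] r by simp
  finally have card: "card (vertices ?S) \<le> r" .
  have "?A \<subseteq> cbox 0 1"
    using n by (auto simp: Basis_vec_def mem_box_cart axis_def)
  then have sub: "?S \<subseteq> cbox 0 1"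
    unfolding corner_simplex_def by (intro hull_minimal convex_box) auto
  have "interior ?S = (*\<^sub>R) (1 / real n) ` interior (convex hull (insert 0 Basis))"
    unfolding corner_simplex_scaled
    by (rule interior_injective_linear_image) (use n in \<open>auto simp: inj_on_def linear_scaleR\<close>)
  then have int: "interior ?S \<noteq> {}"
    using interior_std_simplex_nonempty by auto
  have grid: "\<exists>k::int. v $ i = of_int k * (1 / real n)" if "v \<in> vertices ?S" for v i
  proof -
    have "v \<in> ?A"
      using that V by auto
    then have "v $ i = of_int 0 * (1 / real n) \<or> v $ i = of_int 1 * (1 / real n)"
      by (auto simp: Basis_vec_def axis_def)
    then show ?thesis
      by metis
  qed
  show ?thesis
    unfolding grid_polytope_class_def polytope_class_def
    using card sub int grid by (auto simp: corner_simplex_def intro!: polytope_convex_hull)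
qed

text \<open>The radius is d for a ball around the cube plus d for the growth in d sweeps. The factor
  2 covers both one-sided differences, and the summand 1 the corner simplex.\<close>

definition rounding_const :: "'d::finite itself \<Rightarrow> real" where
  "rounding_const _ =
     2 * (real CARD('d) * measure lebesgue (cball (0 :: real ^ 'd) (2 * real CARD('d)))) + 1"

lemma rounding_const_pos: "rounding_const TYPE('d::finite) > 0"
  unfolding rounding_const_def by (intro add_nonneg_pos mult_nonneg_nonneg) auto

text \<open>The vertices of \<open>P\<close> and the points spanning \<open>?Q\<close> are paired
  with offsets of at most \<open>1 / n\<close> per coordinate, so both one-sided differences are at
  most \<open>c\<close>, whatever \<open>r\<close> is.\<close>

lemma ex_grid_polytope_near:
  fixes P :: "(real ^ 'd) set"
  assumes P: "P \<in> polytope_class r" and n: "n \<ge> 1" and r: "r \<ge> CARD('d) + 1"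
  shows "\<exists>Q\<in>grid_polytope_class n r. measure lebesgue (sym_diff Q P) \<le> rounding_const TYPE('d) / real n"
proof -
  let ?V = "vertices P"
  let ?A = "round_down n ` ?V"
  let ?Q = "convex hull ?A"
  define c where "c = real CARD('d) * measure lebesgue (cball (0 :: real ^ 'd) (2 * real CARD('d))) / real n"
  have poly: "polytope P" and Psub: "P \<subseteq> cbox 0 1" and cardV: "card ?V \<le> r"
    using P by (auto simp: polytope_class_def)
  have PV: "P = convex hull ?V" and finV: "finite ?V"
    using poly polytope_eq_convex_hull_vertices finite_vertices by auto
  have VP: "?V \<subseteq> P"
    using PV hull_subset by metis
  have Acube: "?A \<subseteq> cbox 0 1"
    using VP Psub round_down_mem_cbox[OF n] by blast
  have Qsub: "?Q \<subseteq> cbox 0 1"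
    using Acube by (intro hull_minimal convex_box) auto
  have polyQ: "polytope ?Q"
    using finV by (intro polytope_convex_hull) auto
  have meas: "P \<in> lmeasurable" "?Q \<in> lmeasurable"
    using poly polyQ by (auto intro: lmeasurable_compact polytope_imp_compact)
  have cube_cball: "cbox 0 (1 :: real ^ 'd) \<subseteq> cball 0 (real CARD('d))"
    by (rule unit_cbox_subset_cball)
  \<comment> \<open>No coordinate of a vertex is below that of its rounding, hence the sign 1 here.
    With the roles exchanged further down, the sign is -1.\<close>
  have "measure lebesgue (convex hull ?V - ?Q)
      \<le> real DIM(real ^ 'd) * measure lebesgue (cball (0 :: real ^ 'd) (real CARD('d) + real DIM(real ^ 'd))) / real n"
  proof (rule measure_convex_hull_diff_le[where s = 1])
    show "compact ?Q" "convex ?Q" "?Q \<subseteq> cball 0 (real CARD('d))"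
      using polyQ Qsub cube_cball by (auto intro: polytope_imp_compact)
    show "\<exists>x\<in>?Q. \<forall>b\<in>Basis. 0 \<le> 1 * ((a - x) \<bullet> b) \<and> 1 * ((a - x) \<bullet> b) \<le> 1 / real n"
      if "a \<in> ?V" for a
      using that round_down_bounds[OF n, of a]
      by (intro bexI[of _ "round_down n a"] hull_inc)
        (auto simp: Basis_vec_def inner_axis)
  qed (use n finV in auto)
  then have PQ: "measure lebesgue (P - ?Q) \<le> c"
    using PV by (simp add: c_def)
  have "measure lebesgue (?Q - P)
      \<le> real DIM(real ^ 'd) * measure lebesgue (cball (0 :: real ^ 'd) (real CARD('d) + real DIM(real ^ 'd))) / real n"
  proof (rule measure_convex_hull_diff_le[where s = "-1"])
    show "compact P" "convex P" "P \<subseteq> cball 0 (real CARD('d))"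
      using poly Psub cube_cball by (auto intro: polytope_imp_compact polytope_imp_convex)
    show "\<exists>x\<in>P. \<forall>b\<in>Basis. 0 \<le> - 1 * ((a - x) \<bullet> b) \<and> - 1 * ((a - x) \<bullet> b) \<le> 1 / real n"
      if "a \<in> ?A" for a
    proof -
      from that obtain v where v: "v \<in> ?V" "a = round_down n v"
        by auto
      then show ?thesis
        using VP round_down_bounds[OF n, of v]
        by (intro bexI[of _ v])
          (auto simp: Basis_vec_def inner_axis inner_diff_left algebra_simps)
    qed
  qed (use n finV in auto)
  then have QP: "measure lebesgue (?Q - P) \<le> c"
    by (simp add: c_def)
  have const: "rounding_const TYPE('d) / real n = 2 * c + 1 / real n"
    by (simp add: rounding_const_def c_def add_divide_distrib)
  have c0: "c \<ge> 0"
    by (simp add: c_def)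
  show ?thesis
  proof (cases "interior ?Q = {}")
    case False
    have V: "vertices ?Q \<subseteq> ?A"
      by (rule vertices_convex_hull_subset)
    have "card (vertices ?Q) \<le> card ?A"
      using V finV by (intro card_mono) auto
    also have "\<dots> \<le> r"
      using card_image_le[OF finV] cardV by (rule order_trans)
    finally have "?Q \<in> polytope_class r"
      using False polyQ Qsub by (simp add: polytope_class_def)
    moreover have "\<exists>k::int. v $ i = of_int k * (1 / real n)" if v: "v \<in> vertices ?Q" for v i
    proof -
      obtain u where "v = round_down n u"
        using V v by blast
      then show ?thesis
        by (auto simp: round_down_def)
    qed
    ultimately have "?Q \<in> grid_polytope_class n r"
      by (auto simp: grid_polytope_class_def)
    moreover have "measure lebesgue (sym_diff ?Q P) \<le> rounding_const TYPE('d) / real n"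
    proof -
      have "0 \<le> 1 / real n"
        by simp
      then show ?thesis
        using measure_sym_diff_le[OF meas(2,1)] PQ QP unfolding const by linarith
    qed
    ultimately show ?thesis
      by blast
  next
    case True
    \<comment> \<open>Rounding has collapsed the polytope, so \<open>P\<close> itself is small and any small grid polytope will do.\<close>
    let ?S = "corner_simplex n :: (real ^ 'd) set"
    have "negligible ?Q"
      using True by (simp add: negligible_convex_interior)
    then have "measure lebesgue ?Q = 0"
      by (simp add: negligible_imp_measure0)
    moreover have "measure lebesgue P \<le> measure lebesgue ((P - ?Q) \<union> ?Q)"
      using meas by (intro measure_mono_fmeasurable fmeasurable.Un fmeasurableD fmeasurable.Diff) auto
    moreover have "\<dots> \<le> measure lebesgue (P - ?Q) + measure lebesgue ?Q"
      using meas by (intro measure_Un_le) auto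
    ultimately have mP: "measure lebesgue P \<le> c"
      using PQ by linarith
    have S: "?S \<in> lmeasurable"
      unfolding corner_simplex_def
      by (intro lmeasurable_compact finite_imp_compact_convex_hull) auto
    have "measure lebesgue (sym_diff ?S P) \<le> measure lebesgue (?S \<union> P)"
      using S meas by (intro measure_mono_fmeasurable fmeasurable.Un fmeasurableD sym_diff_lmeasurable) auto
    also have "\<dots> \<le> measure lebesgue ?S + measure lebesgue P"
      using S meas by (intro measure_Un_le) auto
    also have "\<dots> \<le> 1 / real n + c"
      using mP measure_corner_simplex_le[OF n, where 'd = 'd] by linarith
    also have "\<dots> \<le> rounding_const TYPE('d) / real n"
      unfolding const using c0 by simp
    finally show ?thesis
      using corner_simplex_in_grid_polytope_class[OF n r] by blast
  qed
qed

section \<open>Counting the grid polytopes\<close>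

definition grid_points :: "nat \<Rightarrow> (real ^ 'd) set" where
  "grid_points n = (\<lambda>k. \<chi> i. real (k i) * (1 / real n)) ` (UNIV \<rightarrow>\<^sub>E {..n})"

lemma finite_grid_points: "finite (grid_points n :: (real ^ 'd) set)"
  unfolding grid_points_def by (intro finite_imageI finite_PiE) auto

lemma card_grid_points_le: "card (grid_points n :: (real ^ 'd) set) \<le> (n + 1) ^ CARD('d)"
proof -
  have "card (grid_points n :: (real ^ 'd) set) \<le> card ((UNIV :: 'd set) \<rightarrow>\<^sub>E {..n})"
    unfolding grid_points_def by (intro card_image_le finite_PiE) auto
  then show ?thesis
    by (simp add: card_PiE)
qed

lemma grid_polytope_vertices_subset:
  fixes Q :: "(real ^ 'd) set"
  assumes Q: "Q \<in> grid_polytope_class n r" and n: "n \<ge> 1"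
  shows "vertices Q \<subseteq> grid_points n"
proof
  fix v assume v: "v \<in> vertices Q"
  then obtain k :: "'d \<Rightarrow> int" where k: "\<And>i. v $ i = of_int (k i) * (1 / real n)"
    using Q unfolding grid_polytope_class_def by simp metis
  have "v \<in> cbox 0 1"
    using v Q by (auto simp: grid_polytope_class_def polytope_class_def vertices_def extreme_point_of_def)
  then have "0 \<le> v $ i" "v $ i \<le> 1" for i
    by (auto simp: mem_unit_cbox_cart)
  then have "0 \<le> k i" "real_of_int (k i) \<le> real n" for i
    using n by (simp_all add: k field_simps zero_le_mult_iff)
  then have "0 \<le> k i" "k i \<le> int n" for i
    by (simp, metis of_int_le_iff of_int_of_nat_eq)
  then show "v \<in> grid_points n"
    unfolding grid_points_def
    by (intro image_eqI[of _ _ "\<lambda>i. nat (k i)"]) (auto simp: vec_eq_iff k nat_le_iff)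
qed

text \<open>A grid polytope is the hull of at most \<open>r\<close> grid points, so it is determined
  by a map from \<open>{..<r}\<close> into the grid.\<close>

lemma grid_polytope_class_finite_card:
  assumes n: "n \<ge> 1"
  shows "finite (grid_polytope_class n r :: (real ^ 'd) set set)"
    and "card (grid_polytope_class n r :: (real ^ 'd) set set) \<le> (n + 1) ^ (CARD('d) * r)"
proof -
  let ?G = "grid_points n :: (real ^ 'd) set"
  let ?F = "{..<r} \<rightarrow>\<^sub>E ?G"
  have sub: "grid_polytope_class n r \<subseteq> (\<lambda>f. convex hull (f ` {..<r})) ` ?F"
  proof
    fix Q :: "(real ^ 'd) set" assume Q: "Q \<in> grid_polytope_class n r"
    then have poly: "polytope Q" and card: "card (vertices Q) \<le> r" and "Q \<noteq> {}"
      by (auto simp: grid_polytope_class_def polytope_class_def)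
    then have QV: "Q = convex hull (vertices Q)" and fin: "finite (vertices Q)" and ne: "vertices Q \<noteq> {}"
      using polytope_eq_convex_hull_vertices[OF poly] finite_vertices[OF poly] by auto
    obtain g where g: "bij_betw g {..<card (vertices Q)} (vertices Q)"
      using ex_bij_betw_nat_finite[OF fin] by (auto simp: atLeast0LessThan)
    obtain v where v: "v \<in> vertices Q"
      using ne by auto
    \<comment> \<open>With fewer than \<open>r\<close> vertices the enumeration is padded with
      copies of \<open>v\<close>; restriction to \<open>{..<r}\<close> makes \<open>f\<close>
      extensional, as membership in \<open>?F\<close> demands.\<close>
    define f where "f = (\<lambda>i\<in>{..<r}. if i < card (vertices Q) then g i else v)"
    have im: "f ` {..<r} = vertices Q"
      using g v card by (fastforce simp: f_def bij_betw_def)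
    have "f \<in> ?F"
    proof (rule PiE_I)
      show "f i \<in> ?G" if "i \<in> {..<r}" for i
        using imageI[OF that, of f] grid_polytope_vertices_subset[OF Q n] unfolding im by (rule rev_subsetD)
    qed (simp add: f_def)
    then show "Q \<in> (\<lambda>f. convex hull (f ` {..<r})) ` ?F"
      by (intro image_eqI[of _ _ f]) (simp only: im, rule QV)
  qed
  have fin: "finite ?F"
    by (intro finite_PiE finite_grid_points) auto
  show "finite (grid_polytope_class n r :: (real ^ 'd) set set)"
    using sub fin finite_surj by blast
  have "card (grid_polytope_class n r :: (real ^ 'd) set set) \<le> card ?F"
    using sub fin by (rule surj_card_le[rotated])
  also have "\<dots> \<le> ((n + 1) ^ CARD('d)) ^ r"
    using power_mono[OF card_grid_points_le[of n, where 'd = 'd], of r] by (simp add: card_PiE)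
  finally show "card (grid_polytope_class n r :: (real ^ 'd) set set) \<le> (n + 1) ^ (CARD('d) * r)"
    by (simp add: power_mult)
qed

subsection \<open>Exponential moments and the union bound\<close>

lemma emeasure_lborel_unit_cbox: "emeasure lborel (cbox 0 (1 :: real ^ 'd)) = 1"
proof -
  have "measure lborel (cbox 0 (1 :: real ^ 'd)) = 1"
    by (simp add: content_cbox_if_cart interval_eq_empty_cart)
  then show ?thesis
    by (simp add: emeasure_eq_measure2)
qed

lemma emeasure_uniform_unit_cbox:
  assumes "A \<in> sets borel" and "A \<subseteq> cbox 0 (1 :: real ^ 'd)"
  shows "emeasure (uniform_measure lborel (cbox 0 1)) A = ennreal (measure lebesgue A)"
proof -
  have "bounded A"
    using assms(2) bounded_subset bounded_cbox by blast
  then have fin: "emeasure lborel A \<noteq> \<infinity>"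
    using emeasure_bounded_finite by force
  have "emeasure (uniform_measure lborel (cbox 0 1)) A = emeasure lborel A"
    using assms by (simp add: emeasure_lborel_unit_cbox Int_absorb1 divide_ennreal_def)
  also have "\<dots> = ennreal (measure lborel A)"
    using fin by (simp add: emeasure_eq_ennreal_measure)
  also have "measure lborel A = measure lebesgue A"
    using assms by simp
  finally show ?thesis .
qed

lemma prob_space_uniform_unit_cbox: "prob_space (uniform_measure lborel (cbox 0 (1 :: real ^ 'd)))"
  by (rule prob_space_uniform_measure) (simp_all add: emeasure_lborel_unit_cbox)

lemma measurable_observation:
  assumes "G \<in> sets borel"
  shows "(\<lambda>(x, e). (x, indicator G x + e) :: (real ^ 'd) \<times> real)
    \<in> borel \<Otimes>\<^sub>M borel \<rightarrow>\<^sub>M borel \<Otimes>\<^sub>M borel"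
  using assms by measurable

text \<open>Integrating the noise first, with the design point fixed, makes the subgaussian bound
  applicable.\<close>

lemma
  fixes G :: "(real ^ 'd) set"
  assumes \<nu>: "subgaussian_law \<sigma> \<nu>" and G: "G \<in> sets borel"
  shows prob_space_pair_law: "prob_space (pair_law \<nu> G)"
    and nn_integral_pair_law: "g \<in> borel_measurable (borel \<Otimes>\<^sub>M borel) \<Longrightarrow>
      (\<integral>\<^sup>+ z. g z \<partial>pair_law \<nu> G) =
      (\<integral>\<^sup>+ x. \<integral>\<^sup>+ e. g (x, indicator G x + e) \<partial>\<nu> \<partial>uniform_measure lborel (cbox 0 1))"
proof -
  let ?U = "uniform_measure lborel (cbox 0 (1 :: real ^ 'd))"
  let ?f = "\<lambda>(x, e). (x, indicator G x + e) :: (real ^ 'd) \<times> real"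
  interpret \<nu>: prob_space \<nu>
    using \<nu> by (simp add: subgaussian_law_def)
  interpret U: prob_space ?U
    by (rule prob_space_uniform_unit_cbox)
  interpret pair_prob_space ?U \<nu> ..
  have sets: "sets (?U \<Otimes>\<^sub>M \<nu>) = sets (borel \<Otimes>\<^sub>M borel)"
    using \<nu> by (intro sets_pair_measure_cong) (auto simp: subgaussian_law_def)
  have f: "?f \<in> ?U \<Otimes>\<^sub>M \<nu> \<rightarrow>\<^sub>M borel \<Otimes>\<^sub>M borel"
    using measurable_observation[OF G] by (simp add: measurable_cong_sets[OF sets refl])
  show "prob_space (pair_law \<nu> G)"
    unfolding pair_law_def by (rule prob_space_distr[OF f])
  assume g: "g \<in> borel_measurable (borel \<Otimes>\<^sub>M borel)"
  have gf: "(\<lambda>z. g (?f z)) \<in> borel_measurable (?U \<Otimes>\<^sub>M \<nu>)"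
    using measurable_compose[OF f g] .
  have "(\<integral>\<^sup>+ z. g z \<partial>pair_law \<nu> G) = (\<integral>\<^sup>+ z. g (?f z) \<partial>(?U \<Otimes>\<^sub>M \<nu>))"
    unfolding pair_law_def by (rule nn_integral_distr[OF f]) (simp add: g)
  also have "\<dots> = (\<integral>\<^sup>+ x. \<integral>\<^sup>+ e. g (?f (x, e)) \<partial>\<nu> \<partial>?U)"
    by (rule \<nu>.nn_integral_fst[OF gf, symmetric])
  finally show "(\<integral>\<^sup>+ z. g z \<partial>pair_law \<nu> G) =
      (\<integral>\<^sup>+ x. \<integral>\<^sup>+ e. g (x, indicator G x + e) \<partial>\<nu> \<partial>?U)"
    by simp
qed

text \<open>With u = 1 / (4 \<sigma>^2) this is \<open>1 - exp (- (u / 2))\<close>: the conditional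
  moment bound \<open>h\<close> in \<open>exp_moment_le\<close> falls from 1 to
  \<open>exp (- (u / 2))\<close> where \<open>Q\<close> differs from \<open>P\<close> and
  \<open>R\<close> does not.\<close>

definition gain_rate :: "real \<Rightarrow> real" where
  "gain_rate \<sigma> = 1 - exp (- (1 / (8 * \<sigma>\<^sup>2)))"

text \<open>The sum of \<open>exp (3 * u / 2) - 1\<close>, the rise of \<open>h\<close> where only
  \<open>R\<close> differs from \<open>P\<close>, and \<open>gain_rate \<sigma>\<close>, which
  repays the gain credited where both differ.\<close>

definition loss_rate :: "real \<Rightarrow> real" where
  "loss_rate \<sigma> = exp (3 / (8 * \<sigma>\<^sup>2)) - exp (- (1 / (8 * \<sigma>\<^sup>2)))"

lemma gain_rate_pos: "\<sigma> > 0 \<Longrightarrow> gain_rate \<sigma> > 0"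
  by (simp add: gain_rate_def)

lemma loss_rate_pos: "\<sigma> > 0 \<Longrightarrow> loss_rate \<sigma> > 0"
proof -
  assume "\<sigma> > 0"
  then have "- (1 / (8 * \<sigma>\<^sup>2)) < 0" "0 < 3 / (8 * \<sigma>\<^sup>2)"
    by simp_all
  then have "- (1 / (8 * \<sigma>\<^sup>2)) < 3 / (8 * \<sigma>\<^sup>2)"
    by linarith
  then show ?thesis
    by (simp add: loss_rate_def)
qed

text \<open>The parameter \<open>1 / (4 \<sigma>\<^sup>2)\<close> of the exponential moment makes the subgaussian
  factor \<open>exp (2 u\<^sup>2 \<sigma>\<^sup>2)\<close> equal to \<open>exp (u / 2)\<close>, only half of what the signal gains.\<close>

lemma exp_moment_le:
  fixes P Q R :: "(real ^ 'd) set"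
  assumes \<sigma>: "\<sigma> > 0" and \<nu>: "subgaussian_law \<sigma> \<nu>"
    and borel: "P \<in> sets borel" "Q \<in> sets borel" "R \<in> sets borel"
    and sub: "P \<subseteq> cbox 0 1" "Q \<subseteq> cbox 0 1" "R \<subseteq> cbox 0 1"
  shows "(\<integral>\<^sup>+ z. ennreal (exp (1 / (4 * \<sigma>\<^sup>2) *
      ((1 - 2 * snd z) * (indicator R (fst z) - indicator Q (fst z))))) \<partial>pair_law \<nu> P)
    \<le> ennreal (exp (loss_rate \<sigma> * measure lebesgue (sym_diff R P)
        - gain_rate \<sigma> * measure lebesgue (sym_diff Q P)))"
proof -
  let ?U = "uniform_measure lborel (cbox 0 (1 :: real ^ 'd))"
  let ?a = "measure lebesgue (sym_diff Q P)" and ?b = "measure lebesgue (sym_diff R P)"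
  define u where "u = 1 / (4 * \<sigma>\<^sup>2)"
  \<comment> \<open>The bound left after integrating out the noise; the squared term is the
    subgaussian factor for the coefficient of \<open>e\<close>.\<close>
  define h where "h = (\<lambda>x. exp (u * ((1 - 2 * indicator P x) * (indicator R x - indicator Q x))
    + u / 2 * (indicator R x - indicator Q x)\<^sup>2))"
  note [measurable] = borel
  have u: "u > 0"
    using \<sigma> by (simp add: u_def)
  have gain: "gain_rate \<sigma> = 1 - exp (- (u / 2))" and loss: "loss_rate \<sigma> = exp (3 * u / 2) - exp (- (u / 2))"
    by (simp_all add: gain_rate_def loss_rate_def u_def)
  have pos: "gain_rate \<sigma> > 0" "loss_rate \<sigma> > 0"
    using \<sigma> gain_rate_pos loss_rate_pos by auto
  interpret U: prob_space ?U
    by (rule prob_space_uniform_unit_cbox)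
  have sets_\<nu> [measurable_cong]: "sets \<nu> = sets borel"
    using \<nu> by (simp add: subgaussian_law_def)
  have inner: "(\<integral>\<^sup>+ e. ennreal (exp (u * ((1 - 2 * (indicator P x + e)) * (indicator R x - indicator Q x)))) \<partial>\<nu>)
      \<le> ennreal (h x)" for x
  proof -
    define s :: real where "s = indicator R x - indicator Q x"
    define p :: real where "p = indicator P x"
    have "(\<integral>\<^sup>+ e. ennreal (exp (u * ((1 - 2 * (p + e)) * s))) \<partial>\<nu>)
        = (\<integral>\<^sup>+ e. ennreal (exp (u * ((1 - 2 * p) * s))) * ennreal (exp (- 2 * u * s * e)) \<partial>\<nu>)"
      by (intro nn_integral_cong) (simp add: ennreal_mult[symmetric] exp_add[symmetric] algebra_simps)
    also have "\<dots> = ennreal (exp (u * ((1 - 2 * p) * s))) * (\<integral>\<^sup>+ e. ennreal (exp (- 2 * u * s * e)) \<partial>\<nu>)"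
      by (rule nn_integral_cmult) measurable
    also have "\<dots> \<le> ennreal (exp (u * ((1 - 2 * p) * s))) * ennreal (exp ((- 2 * u * s)\<^sup>2 * \<sigma>\<^sup>2 / 2))"
    proof (rule mult_left_mono)
      show "(\<integral>\<^sup>+ e. ennreal (exp (- 2 * u * s * e)) \<partial>\<nu>) \<le> ennreal (exp ((- 2 * u * s)\<^sup>2 * \<sigma>\<^sup>2 / 2))"
        using \<nu> unfolding subgaussian_law_def by blast
    qed simp
    also have "(- 2 * u * s)\<^sup>2 * \<sigma>\<^sup>2 / 2 = u / 2 * s\<^sup>2"
      using \<sigma> by (simp add: u_def field_simps power2_eq_square)
    finally show ?thesis
      by (simp add: s_def p_def h_def exp_add ennreal_mult)
  qed
  \<comment> \<open>\<open>h\<close> is 1 where both or neither of \<open>Q\<close>,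
    \<open>R\<close> agree with \<open>P\<close>, \<open>exp (- (u / 2))\<close> where only
    \<open>R\<close> agrees, and \<open>exp (3 * u / 2)\<close> where only \<open>Q\<close> agrees.
    The gain stands on the left because subtraction in \<open>ennreal\<close> truncates.\<close>
  have pointwise: "ennreal (h x) + ennreal (gain_rate \<sigma>) * indicator (sym_diff Q P) x
      \<le> 1 + ennreal (loss_rate \<sigma>) * indicator (sym_diff R P) x" for x
  proof -
    have "exp (- (u / 2)) \<le> 1" "1 \<le> exp (3 * u / 2)"
      using u by auto
    then have "h x + gain_rate \<sigma> * indicator (sym_diff Q P) x
        \<le> 1 + loss_rate \<sigma> * indicator (sym_diff R P) x"
      unfolding h_def gain loss by (auto simp: indicator_def field_simps split: if_splits)
    then have "ennreal (h x + gain_rate \<sigma> * indicator (sym_diff Q P) x)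
        \<le> ennreal (1 + loss_rate \<sigma> * indicator (sym_diff R P) x)"
      by (rule ennreal_leI)
    then show ?thesis
      using pos by (simp add: h_def ennreal_plus ennreal_mult ennreal_indicator)
  qed
  define I where "I = (\<integral>\<^sup>+ x. ennreal (h x) \<partial>?U)"
  have [measurable]: "h \<in> borel_measurable borel"
    unfolding h_def by measurable
  have eU: "emeasure ?U (sym_diff Q P) = ennreal ?a" "emeasure ?U (sym_diff R P) = ennreal ?b"
    using borel sub by (intro emeasure_uniform_unit_cbox; auto)+
  have "I + ennreal (gain_rate \<sigma>) * ennreal ?a
      = (\<integral>\<^sup>+ x. ennreal (h x) + ennreal (gain_rate \<sigma>) * indicator (sym_diff Q P) x \<partial>?U)"
    unfolding I_def eU[symmetric] by (simp add: nn_integral_add nn_integral_cmult_indicator)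
  also have "\<dots> \<le> (\<integral>\<^sup>+ x. 1 + ennreal (loss_rate \<sigma>) * indicator (sym_diff R P) x \<partial>?U)"
    by (intro nn_integral_mono pointwise)
  also have "\<dots> = 1 + ennreal (loss_rate \<sigma>) * ennreal ?b"
    unfolding eU[symmetric] using U.emeasure_space_1
    by (simp add: nn_integral_add nn_integral_cmult_indicator)
  finally have "I + ennreal (gain_rate \<sigma> * ?a) \<le> ennreal (1 + loss_rate \<sigma> * ?b)"
    using pos by (simp add: ennreal_mult ennreal_plus)
  then have "(I + ennreal (gain_rate \<sigma> * ?a)) - ennreal (gain_rate \<sigma> * ?a)
      \<le> ennreal (1 + loss_rate \<sigma> * ?b) - ennreal (gain_rate \<sigma> * ?a)"
    by (intro ennreal_minus_mono) auto
  then have "I \<le> ennreal (1 + loss_rate \<sigma> * ?b - gain_rate \<sigma> * ?a)"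
    using pos by (simp add: ennreal_minus del: ennreal_plus)
  \<comment> \<open>The exponential form is the one that multiplies well over the sample.\<close>
  also have "\<dots> \<le> ennreal (exp (loss_rate \<sigma> * ?b - gain_rate \<sigma> * ?a))"
    using exp_ge_add_one_self[of "loss_rate \<sigma> * ?b - gain_rate \<sigma> * ?a"]
    by (intro ennreal_leI) linarith
  finally have I: "I \<le> ennreal (exp (loss_rate \<sigma> * ?b - gain_rate \<sigma> * ?a))" .
  have "(\<integral>\<^sup>+ z. ennreal (exp (u *
      ((1 - 2 * snd z) * (indicator R (fst z) - indicator Q (fst z))))) \<partial>pair_law \<nu> P)
    = (\<integral>\<^sup>+ x. \<integral>\<^sup>+ e. ennreal (exp (u * ((1 - 2 * (indicator P x + e)) *
        (indicator R x - indicator Q x)))) \<partial>\<nu> \<partial>?U)"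
    by (subst nn_integral_pair_law[OF \<nu> borel(1)]) simp_all
  also have "\<dots> \<le> I"
    unfolding I_def by (intro nn_integral_mono inner)
  also note I
  finally show ?thesis
    by (simp add: u_def)
qed

text \<open>Chernoff's method: on the event, the exponential of \<open>u\<close> times the criterion
  of \<open>R\<close> minus that of \<open>Q\<close> is at least 1, so Markov's inequality applies
  at level 1, and the product law factors the integral into \<open>n\<close> moments bounded by
  \<open>exp_moment_le\<close>.\<close>

lemma sample_law_comparison_tail:
  fixes P Q R :: "(real ^ 'd) set"
  assumes \<sigma>: "\<sigma> > 0" and \<nu>: "subgaussian_law \<sigma> \<nu>"
    and borel: "P \<in> sets borel" "Q \<in> sets borel" "R \<in> sets borel"
    and sub: "P \<subseteq> cbox 0 1" "Q \<subseteq> cbox 0 1" "R \<subseteq> cbox 0 1"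
  shows "{z \<in> space (sample_law \<nu> n P). emp_criterion n z Q \<le> emp_criterion n z R} \<in> sets (sample_law \<nu> n P)"
    and "emeasure (sample_law \<nu> n P)
      {z \<in> space (sample_law \<nu> n P). emp_criterion n z Q \<le> emp_criterion n z R}
    \<le> ennreal (exp (real n * (loss_rate \<sigma> * measure lebesgue (sym_diff R P)
        - gain_rate \<sigma> * measure lebesgue (sym_diff Q P))))"
proof -
  let ?M = "sample_law \<nu> n P"
  let ?c = "loss_rate \<sigma> * measure lebesgue (sym_diff R P) - gain_rate \<sigma> * measure lebesgue (sym_diff Q P)"
  define u where "u = 1 / (4 * \<sigma>\<^sup>2)"
  define g where "g = (\<lambda>z :: (real ^ 'd) \<times> real.
    ennreal (exp (u * ((1 - 2 * snd z) * (indicator R (fst z) - indicator Q (fst z))))))"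
  note [measurable] = borel
  have [measurable_cong]: "sets (pair_law \<nu> P) = sets (borel \<Otimes>\<^sub>M borel)"
    by (simp add: pair_law_def)
  interpret D: prob_space "pair_law \<nu> P"
    by (rule prob_space_pair_law[OF \<nu> borel(1)])
  interpret product_sigma_finite "\<lambda>_. pair_law \<nu> P" ..
  have [measurable]: "g \<in> borel_measurable (borel \<Otimes>\<^sub>M borel)"
    unfolding g_def by measurable
  have emp [measurable]: "(\<lambda>z. emp_criterion n z S) \<in> borel_measurable ?M" if [measurable]: "S \<in> sets borel" for S
    unfolding emp_criterion_def sample_law_def by measurable
  show "{z \<in> space ?M. emp_criterion n z Q \<le> emp_criterion n z R} \<in> sets ?M"
    by measurable
  have prod: "(\<lambda>z. \<Prod>i\<in>{1..n}. g (z i)) \<in> borel_measurable ?M"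
    unfolding sample_law_def by measurable
  have prod_eq: "(\<Prod>i\<in>{1..n}. g (z i)) = ennreal (exp (u * (emp_criterion n z R - emp_criterion n z Q)))" for z
  proof -
    have "(\<Sum>i=1..n. u * ((1 - 2 * snd (z i)) * (indicator R (fst (z i)) - indicator Q (fst (z i)))))
        = u * (emp_criterion n z R - emp_criterion n z Q)"
      by (simp only: emp_criterion_def sum_distrib_left sum_subtractf[symmetric] right_diff_distrib)
    then show ?thesis
      by (simp add: g_def prod_ennreal exp_sum[symmetric])
  qed
  have "{z \<in> space ?M. emp_criterion n z Q \<le> emp_criterion n z R}
      \<subseteq> {z \<in> space ?M. 1 \<le> 1 * (\<Prod>i\<in>{1..n}. g (z i))}"
    unfolding prod_eq using \<sigma> by (auto simp: u_def)
  then have "emeasure ?M {z \<in> space ?M. emp_criterion n z Q \<le> emp_criterion n z R}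
      \<le> emeasure ?M {z \<in> space ?M. 1 \<le> 1 * (\<Prod>i\<in>{1..n}. g (z i))}"
    using prod by (intro emeasure_mono) (auto, measurable)
  also have "\<dots> \<le> 1 * (\<integral>\<^sup>+ z. (\<Prod>i\<in>{1..n}. g (z i)) * indicator (space ?M) z \<partial>?M)"
    using prod by (intro nn_integral_Markov_inequality) auto
  also have "\<dots> = (\<integral>\<^sup>+ z. (\<Prod>i\<in>{1..n}. g (z i)) \<partial>?M)"
    by (auto intro!: nn_integral_cong)
  also have "\<dots> = (\<Prod>i\<in>{1..n}. \<integral>\<^sup>+ z. g z \<partial>pair_law \<nu> P)"
    unfolding sample_law_def by (rule product_nn_integral_prod) auto
  also have "\<dots> \<le> (\<Prod>i\<in>{1..n}. ennreal (exp ?c))"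
    unfolding g_def u_def by (intro prod_mono_ennreal exp_moment_le assms)
  also have "\<dots> = ennreal (exp (real n * ?c))"
    by (simp add: ennreal_power exp_of_nat_mult)
  finally show "emeasure ?M {z \<in> space ?M. emp_criterion n z Q \<le> emp_criterion n z R}
    \<le> ennreal (exp (real n * ?c))" .
qed

section \<open>Union bound for the estimator\<close>

lemma polytope_class_props:
  assumes "P \<in> polytope_class r"
  shows "P \<in> sets borel" "P \<subseteq> cbox 0 1" "P \<in> lmeasurable"
  using assms
  by (auto simp: polytope_class_def polytope_imp_closed intro: borel_closed lmeasurable_compact polytope_imp_compact)

text \<open>If \<open>phat z\<close> is at distance at least \<open>t\<close> from \<open>P\<close>,
  it is one of the finitely many elements of \<open>B\<close>, and its criterion does not exceed
  that of \<open>R\<close>. The comparison events \<open>E Q\<close>, all with the same bound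
  \<open>c\<close>, thus cover the event.\<close>

lemma estimator_tail_le_comparison_sum:
  fixes P R :: "(real ^ 'd) set"
  assumes \<sigma>: "\<sigma> > 0" and \<nu>: "subgaussian_law \<sigma> \<nu>" and n: "n \<ge> 1"
    and est: "polytope_estimator n r phat"
    and P: "P \<in> polytope_class r" and R: "R \<in> grid_polytope_class n r"
  shows "emeasure (sample_law \<nu> n P)
      {z \<in> space (sample_law \<nu> n P). t \<le> measure lebesgue (sym_diff (phat z) P)}
    \<le> ennreal (real (n + 1) ^ (CARD('d) * r) * exp (real n *
        (loss_rate \<sigma> * measure lebesgue (sym_diff R P) - gain_rate \<sigma> * t)))"
proof -
  let ?M = "sample_law \<nu> n P"
  define B where "B = {Q \<in> grid_polytope_class n r. t \<le> measure lebesgue (sym_diff Q P)}"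
  define E where "E = (\<lambda>Q. {z \<in> space ?M. emp_criterion n z Q \<le> emp_criterion n z R})"
  define c where "c = exp (real n * (loss_rate \<sigma> * measure lebesgue (sym_diff R P) - gain_rate \<sigma> * t))"
  have finB: "finite B"
    by (rule finite_subset[OF _ grid_polytope_class_finite_card(1)[OF n, of r]]) (auto simp: B_def)
  have cardB: "card B \<le> (n + 1) ^ (CARD('d) * r)"
    using card_mono[OF grid_polytope_class_finite_card(1)[OF n], of B r]
      grid_polytope_class_finite_card(2)[OF n, where r = r and 'd = 'd] by (force simp: B_def)
  have grid: "Q \<in> polytope_class r" if "Q \<in> grid_polytope_class n r" for Q :: "(real ^ 'd) set"
    using that by (simp add: grid_polytope_class_def)
  have space: "space ?M = space (sample_space n)"
    by (simp add: sample_law_def sample_space_def space_PiM pair_law_def space_pair_measure)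
  have E: "E Q \<in> sets ?M" "emeasure ?M (E Q) \<le> ennreal c" if "Q \<in> B" for Q
  proof -
    have Q: "Q \<in> polytope_class r" and tQ: "t \<le> measure lebesgue (sym_diff Q P)"
      using that grid by (auto simp: B_def)
    note tail = sample_law_comparison_tail[OF \<sigma> \<nu> polytope_class_props(1)[OF P]
      polytope_class_props(1)[OF Q] polytope_class_props(1)[OF grid[OF R]]
      polytope_class_props(2)[OF P] polytope_class_props(2)[OF Q] polytope_class_props(2)[OF grid[OF R]], of n]
    show "E Q \<in> sets ?M"
      unfolding E_def by (rule tail(1))
    have "gain_rate \<sigma> * t \<le> gain_rate \<sigma> * measure lebesgue (sym_diff Q P)"
      using tQ gain_rate_pos[OF \<sigma>] by simp
    then have "exp (real n * (loss_rate \<sigma> * measure lebesgue (sym_diff R P)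
        - gain_rate \<sigma> * measure lebesgue (sym_diff Q P))) \<le> c"
      unfolding c_def exp_le_cancel_iff by (intro mult_left_mono) auto
    with tail(2) show "emeasure ?M (E Q) \<le> ennreal c"
      unfolding E_def by (meson ennreal_leI order_trans)
  qed
  have "{z \<in> space ?M. t \<le> measure lebesgue (sym_diff (phat z) P)} \<subseteq> (\<Union>Q\<in>B. E Q)"
  proof clarsimp
    fix z assume z: "z \<in> space ?M" "t \<le> measure lebesgue (sym_diff (phat z) P)"
    have "is_arg_min (emp_criterion n z) (\<lambda>Q. Q \<in> grid_polytope_class n r) (phat z)"
      using est z space by (auto simp: polytope_estimator_def)
    then have "phat z \<in> grid_polytope_class n r" "emp_criterion n z (phat z) \<le> emp_criterion n z R"
      using R by (auto simp: is_arg_min_linorder)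
    then show "\<exists>Q\<in>B. z \<in> E Q"
      using z by (auto simp: B_def E_def)
  qed
  then have "emeasure ?M {z \<in> space ?M. t \<le> measure lebesgue (sym_diff (phat z) P)}
      \<le> emeasure ?M (\<Union>Q\<in>B. E Q)"
    using E finB by (intro emeasure_mono) auto
  also have "\<dots> \<le> (\<Sum>Q\<in>B. emeasure ?M (E Q))"
    using E finB by (intro emeasure_subadditive_finite) auto
  also have "\<dots> \<le> (\<Sum>Q\<in>B. ennreal c)"
    using E by (intro sum_mono)
  also have "\<dots> = ennreal (real (card B) * c)"
    by (simp add: c_def ennreal_mult ennreal_of_nat_eq_real_of_nat)
  also have "\<dots> \<le> ennreal (real ((n + 1) ^ (CARD('d) * r)) * c)"
    using cardB by (intro ennreal_leI mult_right_mono) (auto simp: c_def simp del: of_nat_power)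
  finally show ?thesis
    by (simp add: c_def)
qed

text \<open>The inequality n + 1 \<le> n^2 is the source of the factor 2 in 2 d r ln n. It fails at
  \<open>n = 1\<close>, which the theorem treats separately.\<close>

lemma power_le_exp_ln:
  assumes "n \<ge> (2::nat)"
  shows "real (n + 1) ^ m \<le> exp (2 * real m * ln (real n))"
proof -
  have "real (n + 1) \<le> real (n ^ 2)"
    using mult_le_mono2[OF assms, of n] assms unfolding of_nat_le_iff power2_eq_square by linarith
  then have "real (n + 1) ^ m \<le> (real n ^ 2) ^ m"
    by (intro power_mono) auto
  also have "\<dots> = exp (real (2 * m) * ln (real n))"
    using assms by (subst exp_of_nat_mult) (simp add: power_mult)
  finally show ?thesis
    by (simp add: mult_ac)
qed

theorem theorem1:
  fixes \<sigma> :: real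
  assumes "CARD('d::finite) \<ge> 2" and "\<sigma> > 0"
  shows "\<exists>C1 C2 :: real. C1 > 0 \<and> C2 > 0 \<and>
    (\<forall>\<nu>. subgaussian_law \<sigma> \<nu> \<longrightarrow>
      (\<forall>n r :: nat. n \<ge> 1 \<longrightarrow> r \<ge> CARD('d) + 1 \<longrightarrow>
        (\<forall>phat :: (nat \<Rightarrow> (real ^ 'd) \<times> real) \<Rightarrow> (real ^ 'd) set.
          polytope_estimator n r phat \<longrightarrow>
          (\<forall>x>0.
            (SUP P\<in>polytope_class r.
               emeasure (sample_law \<nu> n P)
                 {z \<in> space (sample_law \<nu> n P).
                    real n * (measure lebesgue (sym_diff (phat z) P)
                      - 2 * real CARD('d) * real r * ln (real n) / (C2 * real n)) \<ge> x})
            \<le> ennreal (C1 * exp (- C2 * x))))))"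
proof -
  \<comment> \<open>\<open>\<kappa>\<close> becomes \<open>C2\<close> and
    \<open>exp (C + \<kappa>)\<close> becomes \<open>C1\<close>: \<open>C\<close> bounds
    \<open>n\<close> times the loss caused by rounding, and the extra \<open>\<kappa>\<close> serves
    the case \<open>n = 1\<close>, \<open>x \<le> 1\<close>.\<close>
  define \<kappa> where "\<kappa> = gain_rate \<sigma>"
  define C where "C = loss_rate \<sigma> * rounding_const TYPE('d)"
  have \<kappa>: "\<kappa> > 0"
    using assms gain_rate_pos by (simp add: \<kappa>_def)
  have C: "C > 0"
    unfolding C_def using assms loss_rate_pos rounding_const_pos by (intro mult_pos_pos) auto
  have bound: "emeasure (sample_law \<nu> n P) {z \<in> space (sample_law \<nu> n P).
        real n * (measure lebesgue (sym_diff (phat z) P)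
          - 2 * real CARD('d) * real r * ln (real n) / (\<kappa> * real n)) \<ge> x}
      \<le> ennreal (exp (C + \<kappa>) * exp (- \<kappa> * x))"
    if \<nu>: "subgaussian_law \<sigma> \<nu>" and n: "n \<ge> 1" and r: "r \<ge> CARD('d) + 1"
      and est: "polytope_estimator n r phat" and P: "P \<in> polytope_class r" and x: "x > 0"
    for \<nu> n r x and phat :: "(nat \<Rightarrow> (real ^ 'd) \<times> real) \<Rightarrow> (real ^ 'd) set" and P
  proof -
    let ?M = "sample_law \<nu> n P"
    define m where "m = CARD('d) * r"
    \<comment> \<open>Chosen so that \<open>n * \<kappa> * t = \<kappa> * x + 2 * m * ln n\<close>;
      the logarithm cancels the number of grid polytopes.\<close>
    define t where "t = (x + 2 * real m * ln (real n) / \<kappa>) / real n"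
    have "real n * (y - 2 * real CARD('d) * real r * ln (real n) / (\<kappa> * real n))
        = real n * y - 2 * real m * ln (real n) / \<kappa>" for y
      using n by (simp add: m_def right_diff_distrib)
    then have "x \<le> real n * (y - 2 * real CARD('d) * real r * ln (real n) / (\<kappa> * real n)) \<longleftrightarrow> t \<le> y" for y
      using n by (simp add: t_def m_def divide_le_eq algebra_simps)
    then have event: "{z \<in> space ?M. real n * (measure lebesgue (sym_diff (phat z) P)
          - 2 * real CARD('d) * real r * ln (real n) / (\<kappa> * real n)) \<ge> x}
        = {z \<in> space ?M. t \<le> measure lebesgue (sym_diff (phat z) P)}"
      by simp
    \<comment> \<open>For \<open>n = 1\<close> the logarithm vanishes and cannot absorb the union
      bound. If \<open>x \<le> 1\<close>, the claimed bound is at least 1; if \<open>x > 1\<close>,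
      the event is empty, since the symmetric difference lies in the unit cube.\<close>
    show ?thesis
    proof (cases "n = 1 \<and> x \<le> 1")
      case True
      interpret D: prob_space "pair_law \<nu> P"
        by (rule prob_space_pair_law[OF \<nu> polytope_class_props(1)[OF P]])
      interpret S: prob_space ?M
        unfolding sample_law_def by (intro prob_space_PiM) unfold_locales
      have "1 \<le> exp (C + \<kappa> + - \<kappa> * x)"
      proof -
        have "\<kappa> * x \<le> \<kappa> * 1"
          using True \<kappa> by (intro mult_left_mono) auto
        then show ?thesis
          using C by simp
      qed
      then have "ennreal 1 \<le> ennreal (exp (C + \<kappa>) * exp (- \<kappa> * x))"
        unfolding exp_add by (rule ennreal_leI)
      then show ?thesis
        using S.measure_le_1 by (metis (no_types, lifting) S.emeasure_le_1 ennreal_1 order_trans)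
    next
      case False
      obtain R where R: "R \<in> grid_polytope_class n r"
        and Rm: "measure lebesgue (sym_diff R P) \<le> rounding_const TYPE('d) / real n"
        using ex_grid_polytope_near[OF P n r] by blast
      have "loss_rate \<sigma> * measure lebesgue (sym_diff R P) \<le> loss_rate \<sigma> * (rounding_const TYPE('d) / real n)"
        using Rm loss_rate_pos[OF assms(2)] by (intro mult_left_mono) auto
      then have "real n * (loss_rate \<sigma> * measure lebesgue (sym_diff R P) - \<kappa> * t)
          \<le> real n * (C / real n - \<kappa> * t)"
        by (intro mult_left_mono) (auto simp: C_def)
      also have "\<dots> = C - \<kappa> * x - 2 * real m * ln (real n)"
        using n \<kappa> by (simp add: t_def field_simps)
      finally have expo: "exp (real n * (loss_rate \<sigma> * measure lebesgue (sym_diff R P) - \<kappa> * t))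
          \<le> exp (C - \<kappa> * x - 2 * real m * ln (real n))"
        by simp
      show ?thesis
      proof (cases "n = 1")
        case True
        have "\<not> t \<le> measure lebesgue (sym_diff (phat z) P)" if "z \<in> space ?M" for z
        proof -
          have "z \<in> space (sample_space n)"
            using that by (simp add: sample_law_def sample_space_def space_PiM pair_law_def space_pair_measure)
          then have "phat z \<in> polytope_class r"
            using est by (auto simp: polytope_estimator_def is_arg_min_def grid_polytope_class_def)
          then have "measure lebesgue (sym_diff (phat z) P) \<le> measure lebesgue (cbox 0 (1 :: real ^ 'd))"
            using polytope_class_props[OF P] polytope_class_props[of "phat z" r]
            by (intro measure_mono_fmeasurable fmeasurableD sym_diff_lmeasurable) auto
          also have "\<dots> = 1"
            by (simp add: content_cbox_if_cart interval_eq_empty_cart)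
          finally show ?thesis
            using True False by (simp add: t_def)
        qed
        then have empty: "{z \<in> space ?M. t \<le> measure lebesgue (sym_diff (phat z) P)} = {}"
          by blast
        show ?thesis
          unfolding event empty by simp
      next
        case False
        with n have n2: "n \<ge> 2"
          by simp
        have "real (n + 1) ^ m * exp (real n * (loss_rate \<sigma> * measure lebesgue (sym_diff R P) - \<kappa> * t))
            \<le> exp (2 * real m * ln (real n)) * exp (C - \<kappa> * x - 2 * real m * ln (real n))"
          by (intro mult_mono power_le_exp_ln expo n2) auto
        also have "\<dots> = exp (C + - \<kappa> * x)"
          by (simp flip: exp_add)
        also have "\<dots> \<le> exp (C + \<kappa>) * exp (- \<kappa> * x)"
          using \<kappa> by (simp flip: exp_add)
        finally show ?thesis
          unfolding event
          using estimator_tail_le_comparison_sum[OF assms(2) \<nu> n est P R, of t]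
          by (fold m_def \<kappa>_def) (meson ennreal_leI order_trans)
      qed
    qed
  qed
  show ?thesis
    by (rule exI[of _ "exp (C + \<kappa>)"], rule exI[of _ \<kappa>],
        intro conjI allI impI SUP_least) (rule exp_gt_zero, rule \<kappa>, rule bound)
qed

end
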